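(* There exists an infinite binary word over $\{0,1\}$ all of whose (finite) factors have exponent at most $7/3$ and which contains exactly $12$ distinct squares as factors. Moreover, $12$ is the fewest possible: every infinite binary word all of whose factors have exponent at most $7/3$ contains at least $12$ distinct squares as factors.
   Context: A word has period $p$ if its letters at distance $p$ are equal. The exponent of a nonempty finite word is its length divided by its smallest period. A square is a word of the form $uu$ with $u$ a nonempty finite word. A factor of a word is a contiguous finite subword; squares are counted as distinct words (regardless of the number of occurrences). *)

theory Defs
  imports Complex_Main "HOL-Library.Omega_Words_Fun"
begin

text \<open>Infinite words are of type \<^typ>\<open>'a word\<close>, that is \<^typ>\<open>nat \<Rightarrow> 'a\<close>; finite words are lists.\<close>

definition has_period :: "'a list \<Rightarrow> nat \<Rightarrow> bool" where
  "has_period u p \<longleftrightarrow> p > 0 \<and> (\<forall>i. i + p < length u \<longrightarrow> u ! i = u ! (i + p))"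

text \<open>The length of a nonempty word is vacuously one of its periods, so the minimum exists
  and is at most the length.\<close>

definition smallest_period :: "'a list \<Rightarrow> nat" where
  "smallest_period u = (LEAST p. has_period u p)"

definition exponent :: "'a list \<Rightarrow> real" where
  "exponent u = real (length u) / real (smallest_period u)"

definition is_square :: "'a list \<Rightarrow> bool" where
  "is_square s \<longleftrightarrow> (\<exists>u. u \<noteq> [] \<and> s = u @ u)"

definition factors :: "'a word \<Rightarrow> 'a list set" where
  "factors w = {w [i \<rightarrow> j] | i j. i \<le> j}"

definition square_factors :: "'a word \<Rightarrow> 'a list set" where
  "square_factors w = {s \<in> factors w. is_square s}"

definition exponents_at_most :: "real \<Rightarrow> 'a word \<Rightarrow> bool" where
  "exponents_at_most e w \<longleftrightarrow> (\<forall>u \<in> factors w. u \<noteq> [] \<longrightarrow> exponent u \<le> e)"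

definition binary_word :: "nat word \<Rightarrow> bool" where
  "binary_word w \<longleftrightarrow> range w \<subseteq> {0, 1}"

end

theory Submission
  imports Defs
begin

text \<open>Lower bound: a depth-first search shows that no infinite binary word has all exponents at most
  7/3 and at most 11 squares; the search tree is finite.

  Upper bound: the word is \<open>H(x)\<close> for a fixed point \<open>x\<close> of a morphism \<open>G\<close> on six letters. Block
  boundaries in \<open>G(x)\<close> and \<open>H(x)\<close> are recognisable from a short marker, so a long repetition of
  period \<open>p\<close> in either image comes from a maximal repetition of some period \<open>k < p\<close> in \<open>x\<close>. How much
  the latter falls short of a square, measured after applying \<open>H\<close>, is its defect: the length of the
  image of the missing letters minus the common suffix and common prefix at the two mismatches.
  All defects are positive: this is checked for small periods and passes from \<open>x\<close> to \<open>G(x) = x\<close> by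
  a finite case analysis on the letters at the two mismatches, because missing at least three letters
  is always enough. Hence \<open>H(x)\<close> has no square of large period, and the small periods are checked
  directly.\<close>

subsection \<open>Images of infinite words under morphisms\<close>

fun lcp_length :: "'a list \<Rightarrow> 'a list \<Rightarrow> nat" where
  "lcp_length (x # xs) (y # ys) = (if x = y then Suc (lcp_length xs ys) else 0)"
| "lcp_length [] ys = 0"
| "lcp_length (x # xs) [] = 0"

lemma lcp_length_le: "lcp_length xs ys \<le> length xs" "lcp_length xs ys \<le> length ys"
  by (induction xs ys rule: lcp_length.induct) auto

lemma nth_less_lcp_length: "i < lcp_length xs ys \<Longrightarrow> xs ! i = ys ! i"
  by (induction xs ys arbitrary: i rule: lcp_length.induct) (auto simp: nth_Cons' split: if_splits)

lemma nth_lcp_length: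
  "lcp_length xs ys < length xs \<Longrightarrow> lcp_length xs ys < length ys \<Longrightarrow>
    xs ! lcp_length xs ys \<noteq> ys ! lcp_length xs ys"
  by (induction xs ys rule: lcp_length.induct) auto

lemma lcp_length_geI:
  assumes "n \<le> length xs" "n \<le> length ys" "\<And>i. i < n \<Longrightarrow> xs ! i = ys ! i"
  shows "n \<le> lcp_length xs ys"
proof (rule ccontr)
  assume "\<not> n \<le> lcp_length xs ys"
  then show False using nth_lcp_length[of xs ys] assms by auto
qed

definition block_start :: "('a \<Rightarrow> 'b list) \<Rightarrow> 'a word \<Rightarrow> nat \<Rightarrow> nat" where
  "block_start F x n = length (concat (map F (map x [0..<n])))"

text \<open>A relation between words, tested on prefixes: it needs no limit of finite words and
  applies equally to a word that is its own image.\<close>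

definition image_word :: "('a \<Rightarrow> 'b list) \<Rightarrow> 'a word \<Rightarrow> 'b word \<Rightarrow> bool" where
  "image_word F x u \<longleftrightarrow>
     (\<forall>n. concat (map F (map x [0..<n])) = map u [0..<block_start F x n])"

lemma block_start_0 [simp]: "block_start F x 0 = 0"
  by (simp add: block_start_def)

lemma block_start_Suc: "block_start F x (Suc n) = block_start F x n + length (F (x n))"
  by (simp add: block_start_def)

lemma image_word_nth:
  assumes "image_word F x u" "j < length (F (x n))"
  shows "u (block_start F x n + j) = F (x n) ! j"
proof -
  have "concat (map F (map x [0..<Suc n])) = map u [0..<block_start F x (Suc n)]"
    using assms(1) unfolding image_word_def by blast
  moreover have "concat (map F (map x [0..<Suc n])) ! (block_start F x n + j) = F (x n) ! j"
    by (simp add: block_start_def nth_append)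
  ultimately show ?thesis
    using assms(2) by (simp add: block_start_Suc)
qed

lemma image_wordI:
  assumes "\<And>n j. j < length (F (x n)) \<Longrightarrow> u (block_start F x n + j) = F (x n) ! j"
  shows "image_word F x u"
  unfolding image_word_def
proof
  fix n
  show "concat (map F (map x [0..<n])) = map u [0..<block_start F x n]"
  proof (induction n)
    case (Suc n)
    have "F (x n) = map u [block_start F x n..<block_start F x (Suc n)]"
      by (rule nth_equalityI) (auto simp: block_start_Suc assms)
    moreover have "[0..<block_start F x (Suc n)] =
        [0..<block_start F x n] @ [block_start F x n..<block_start F x (Suc n)]"
      unfolding block_start_Suc by (rule upt_add_eq_append) simp
    ultimately show ?case using Suc by simp
  qed simp
qed

text \<open>Makes powers of a morphism available as single morphisms, whose blocks are long enough
  for the finite window checks.\<close>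

lemma image_word_comp:
  assumes "image_word F x u" "image_word Q u v"
  shows "image_word (\<lambda>c. concat (map Q (F c))) x v"
proof -
  have *: "concat (map (\<lambda>c. concat (map Q (F c))) (map x [0..<n])) =
      map v [0..<block_start Q u (block_start F x n)]" for n
  proof -
    have "concat (map (\<lambda>c. concat (map Q (F c))) ys) = concat (map Q (concat (map F ys)))" for ys
      by (induction ys) auto
    then show ?thesis using assms unfolding image_word_def by metis
  qed
  moreover from this have "block_start (\<lambda>c. concat (map Q (F c))) x n = block_start Q u (block_start F x n)" for n
    unfolding block_start_def[of "\<lambda>c. concat (map Q (F c))"] by (metis diff_zero length_map length_upt)
  ultimately show ?thesis unfolding image_word_def by simp
qed

text \<open>The image of the first \<open>Suc t\<close> letters reaches position \<open>t\<close> as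
  soon as no block is empty.\<close>

definition image_of :: "('a \<Rightarrow> 'b list) \<Rightarrow> 'a word \<Rightarrow> 'b word" where
  "image_of F x t = concat (map F (map x [0..<Suc t])) ! t"

lemma block_start_ge:
  assumes "\<And>c. F c \<noteq> []"
  shows "block_start F x m + n \<le> block_start F x (m + n)"
proof (induction n)
  case (Suc n)
  have "length (F (x (m + n))) > 0" using assms by simp
  then show ?case using Suc unfolding add_Suc_right block_start_Suc by linarith
qed simp

lemma concat_take_prefix:
  assumes "m \<le> n" "t < block_start F x m"
  shows "concat (map F (map x [0..<n])) ! t = concat (map F (map x [0..<m])) ! t"
proof -
  have "[0..<n] = [0..<m] @ [m..<n]" using assms(1) by (metis le_add_diff_inverse upt_add_eq_append zero_le)
  then show ?thesis using assms(2) by (simp add: block_start_def nth_append)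
qed

lemma image_word_image_of:
  assumes "\<And>c. F c \<noteq> []"
  shows "image_word F x (image_of F x)"
proof (rule image_wordI)
  fix n j assume j: "j < length (F (x n))"
  let ?t = "block_start F x n + j"
  have t: "?t < block_start F x (Suc n)" using j by (simp add: block_start_Suc)
  have t': "?t < block_start F x (Suc ?t)" using block_start_ge[of F x 0 "Suc ?t"] assms by simp
  have n: "n \<le> ?t" using block_start_ge[of F x 0 n] assms by (simp add: trans_le_add1)
  have "image_of F x ?t = concat (map F (map x [0..<Suc n])) ! ?t"
    unfolding image_of_def using concat_take_prefix[OF _ t, of "Suc ?t"] n by simp
  also have "\<dots> = F (x n) ! j" by (simp add: block_start_def nth_append)
  finally show "image_of F x ?t = F (x n) ! j" .
qed

lemma image_word_position:
  assumes "\<And>c. F c \<noteq> []"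
  obtains n j where "t = block_start F x n + j" "j < length (F (x n))"
proof -
  have "\<exists>n j. t = block_start F x n + j \<and> j < length (F (x n))"
  proof (induction t)
    case 0
    then show ?case using assms by (metis add_0 block_start_0 length_greater_0_conv)
  next
    case (Suc t)
    then obtain n j where nj: "t = block_start F x n + j" "j < length (F (x n))" by blast
    show ?case
    proof (cases "Suc j < length (F (x n))")
      case True
      then show ?thesis using nj by (metis add_Suc_right)
    next
      case False
      then have "Suc t = block_start F x (Suc n) + 0" using nj by (simp add: block_start_Suc)
      then show ?thesis using assms by (metis length_greater_0_conv)
    qed
  qed
  then show ?thesis using that by blast
qed

text \<open>Prefixes suffice, since every factor lies in one. Recurrence serves to move a repetition
  far to the right, so that it can be extended leftwards without meeting the start of the
  word.\<close>

definition recurrent :: "'a word \<Rightarrow> bool" where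
  "recurrent x \<longleftrightarrow> (\<forall>n b. \<exists>d\<ge>b. \<forall>t<n. x (t + d) = x t)"

lemma block_start_shift:
  assumes "\<forall>t<n. x (t + d) = x t" "m \<le> n"
  shows "block_start F x (m + d) = block_start F x d + block_start F x m"
  using assms(2)
proof (induction m)
  case (Suc m)
  then show ?case using assms(1) by (simp add: block_start_Suc)
qed simp

lemma image_word_shift:
  assumes F: "\<And>c. F c \<noteq> []" and im: "image_word F x u"
    and sh: "\<forall>t<n. x (t + d) = x t" and t: "t < block_start F x n"
  shows "u (t + block_start F x d) = u t"
proof -
  obtain m j where mj: "t = block_start F x m + j" "j < length (F (x m))"
    using image_word_position[of F t x] F by blast
  have "m < n"
  proof (rule ccontr)
    assume "\<not> m < n"
    then have "block_start F x n \<le> block_start F x m"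
      using block_start_ge[of F x n "m - n"] F by simp
    then show False using t mj by simp
  qed
  then have "u (t + block_start F x d) = u (block_start F x (m + d) + j)"
    using block_start_shift[OF sh, of m F] mj by (simp add: ac_simps)
  also have "\<dots> = u t"
    using image_word_nth[OF im, of j m] image_word_nth[OF im, of j "m + d"] mj sh \<open>m < n\<close> by simp
  finally show ?thesis .
qed

lemma recurrent_image:
  assumes F: "\<And>c. F c \<noteq> []" and im: "image_word F x u" and "recurrent x"
  shows "recurrent u"
  unfolding recurrent_def
proof (intro allI)
  fix n b
  obtain d where d: "d \<ge> b" "\<forall>t<n. x (t + d) = x t"
    using assms(3) unfolding recurrent_def by blast
  have "n \<le> block_start F x n" "d \<le> block_start F x d"
    using block_start_ge[of F x 0] F by simp_all
  then show "\<exists>d\<ge>b. \<forall>t<n. u (t + d) = u t"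
    using image_word_shift[OF F im d(2)] d(1) by (meson le_trans less_le_trans)
qed

text \<open>No block is shorter than the window, so a window starting in one block ends at the
  latest in the next. A property of all windows thus reduces to a check of pairs of blocks.\<close>

lemma image_word_window:
  assumes im: "image_word F x u" and len: "\<And>c. l \<le> length (F c)" and l: "0 < l"
  obtains n k where "k < length (F (x n))"
    "\<And>t. t < l \<Longrightarrow> u (q + t) = (F (x n) @ F (x (Suc n))) ! (k + t)"
proof -
  have F: "\<And>c. F c \<noteq> []" using len l by (metis le_zero_eq length_0_conv less_irrefl)
  then obtain n k where nk: "q = block_start F x n + k" "k < length (F (x n))"
    using image_word_position[of F q x] by blast
  have "u (q + t) = (F (x n) @ F (x (Suc n))) ! (k + t)" if t: "t < l" for t
  proof (cases "k + t < length (F (x n))")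
    case True
    then show ?thesis
      using image_word_nth[OF im, of "k + t" n] nk by (simp add: nth_append add.assoc)
  next
    case False
    let ?j = "k + t - length (F (x n))"
    have "?j < length (F (x (Suc n)))" using t nk(2) len[of "x (Suc n)"] False by linarith
    moreover have "q + t = block_start F x (Suc n) + ?j" using nk False by (simp add: block_start_Suc)
    ultimately show ?thesis
      using image_word_nth[OF im, of ?j "Suc n"] False by (simp add: nth_append)
  qed
  then show ?thesis using that nk(2) by blast
qed

subsection \<open>Desubstitution of repetitions\<close>

text \<open>A repetition is recorded by the positions whose letter recurs \<open>p\<close> later: a
  factor of period \<open>p\<close> and length \<open>l\<close> at \<open>i\<close> has
  \<open>j = i + l - p\<close>, and a square has \<open>j = i + p\<close>.\<close>

definition matches :: "'a word \<Rightarrow> nat \<Rightarrow> nat \<Rightarrow> nat \<Rightarrow> bool" where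
  "matches u p i j \<longleftrightarrow> (\<forall>t. i \<le> t \<and> t < j \<longrightarrow> u t = u (t + p))"

lemma matchesD: "matches u p i j \<Longrightarrow> i \<le> t \<Longrightarrow> t < j \<Longrightarrow> u t = u (t + p)"
  by (simp add: matches_def)

lemma matches_shift:
  assumes "\<forall>t<n. u (t + d) = u t" "j + p \<le> n" "matches u p i j"
  shows "matches u p (i + d) (j + d)"
  unfolding matches_def
proof (intro allI impI)
  fix t assume t: "i + d \<le> t \<and> t < j + d"
  then have "u (t - d) = u (t - d + p)" using assms(3) by (intro matchesD[of u p i j]) auto
  moreover have "t - d < n" "t - d + p < n" using assms(2) t by linarith+
  then have "u (t - d + d) = u (t - d)" "u (t - d + p + d) = u (t - d + p)"
    using assms(1) by blast+
  moreover have "t - d + d = t" "t - d + p + d = t + p" using t by simp_all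
  ultimately show "u t = u (t + p)" by simp
qed

lemma lcp_length_commute: "lcp_length xs ys = lcp_length ys xs"
  by (induction xs ys rule: lcp_length.induct) (auto, metis lcp_length.simps list.exhaust)

text \<open>With \<open>T c\<close> the forced start of the block after \<open>F c\<close>, this
  measures how far a repetition in the image continues to the right past a mismatch of
  \<open>c\<close> and \<open>d\<close>.\<close>

definition common_prefix :: "('a \<Rightarrow> 'b list) \<Rightarrow> ('a \<Rightarrow> 'b list) \<Rightarrow> 'a \<Rightarrow> 'a \<Rightarrow> nat" where
  "common_prefix F T c d = lcp_length (F c @ T c) (F d @ T d)"

definition common_suffix :: "('a \<Rightarrow> 'b list) \<Rightarrow> 'a \<Rightarrow> 'a \<Rightarrow> nat" where
  "common_suffix F c d = lcp_length (rev (F c)) (rev (F d))"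

text \<open>The first \<open>ml\<close> letters of a block are its marker, and \<open>T c\<close> is
  meant to be the marker of whatever block follows \<open>F c\<close>. Markers can be seen only at
  block boundaries, and distinct letters force a mismatch on the left within their blocks and on the
  right within block and tail.\<close>

locale marked_code =
  fixes F T :: "'a \<Rightarrow> 'b list" and ml max_len :: nat
  assumes tail_length: "length (T c) = ml"
    and len_ge: "2 \<le> length (F c)" and len_le: "length (F c) \<le> max_len" and marker_le: "ml \<le> length (F c)"
    and marker: "j < length (F c) \<Longrightarrow> take ml (drop j (F c @ T c)) = take ml (F d) \<Longrightarrow> j = 0"
    and prefix_free: "c \<noteq> d \<Longrightarrow> lcp_length (F c @ T c) (F d @ T d) < length (F c @ T c)"
    and suffix_free: "c \<noteq> d \<Longrightarrow> lcp_length (rev (F c)) (rev (F d)) < length (F c)"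
begin

abbreviation "pre \<equiv> common_prefix F T"
abbreviation "suf \<equiv> common_suffix F"

lemma pre_less: "c \<noteq> d \<Longrightarrow> pre c d < length (F c @ T c)" "c \<noteq> d \<Longrightarrow> pre c d < length (F d @ T d)"
  unfolding common_prefix_def using prefix_free[of c d] prefix_free[of d c]
  by (simp_all add: lcp_length_commute[of "F d @ T d"])

lemma suf_less: "c \<noteq> d \<Longrightarrow> suf c d < length (F c)" "c \<noteq> d \<Longrightarrow> suf c d < length (F d)"
  unfolding common_suffix_def using suffix_free[of c d] suffix_free[of d c]
  by (simp_all add: lcp_length_commute[of "rev (F d)"])

lemma pre_mismatch: "c \<noteq> d \<Longrightarrow> (F c @ T c) ! pre c d \<noteq> (F d @ T d) ! pre c d"
  using pre_less[of c d] unfolding common_prefix_def by (intro nth_lcp_length) auto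

lemma suf_mismatch: "c \<noteq> d \<Longrightarrow> rev (F c) ! suf c d \<noteq> rev (F d) ! suf c d"
  using suf_less[of c d] unfolding common_suffix_def by (intro nth_lcp_length) auto

end

locale marked_image = marked_code +
  fixes x :: "'a word" and u :: "'b word"
  assumes image: "image_word F x u"
    and follow: "take ml (F (x (Suc n))) = T (x n)"
begin

abbreviation "s \<equiv> block_start F x"

lemma nonempty: "F c \<noteq> []"
  using len_ge[of c] by auto

lemma s_ge: "s m + 2 * n \<le> s (m + n)"
proof (induction n)
  case (Suc n)
  then show ?case using len_ge[of "x (m + n)"] by (simp add: block_start_Suc)
qed simp

lemma s_mono: "m \<le> n \<Longrightarrow> s m \<le> s n"
  using s_ge[of m "n - m"] by simp

lemma s_less: "m < n \<Longrightarrow> s m < s n"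
  using s_ge[of m "n - m"] by simp

lemma u_nth:
  assumes "j < length (F (x n) @ T (x n))"
  shows "u (s n + j) = (F (x n) @ T (x n)) ! j"
proof (cases "j < length (F (x n))")
  case True
  then show ?thesis using image_word_nth[OF image True] by (simp add: nth_append)
next
  case False
  let ?j = "j - length (F (x n))"
  have j: "?j < ml" using assms False by (simp add: tail_length)
  have "u (s n + j) = u (s (Suc n) + ?j)" using False by (simp add: block_start_Suc)
  also have "\<dots> = F (x (Suc n)) ! ?j"
    using j marker_le[of "x (Suc n)"] by (intro image_word_nth[OF image]) simp
  also have "\<dots> = T (x n) ! ?j" using follow[of n] j by (metis nth_take)
  finally show ?thesis using False by (simp add: nth_append)
qed

lemma u_rev_nth:
  assumes "j < length (F (x n))"
  shows "u (s (Suc n) - Suc j) = rev (F (x n)) ! j"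
proof -
  have "s (Suc n) - Suc j = s n + (length (F (x n)) - Suc j)"
    using assms by (simp add: block_start_Suc)
  then show ?thesis using assms image_word_nth[OF image, of "length (F (x n)) - Suc j" n]
    by (simp add: rev_nth)
qed

text \<open>The copy of a marker \<open>p\<close> places further is again a marker, hence sits at a
  block boundary.\<close>

lemma synchronised:
  assumes "matches u p (s n) (s n + ml)"
  shows "\<exists>n'. s n' = s n + p"
proof -
  obtain n' j where nj: "s n + p = s n' + j" "j < length (F (x n'))"
    using image_word_position[of F "s n + p" x] nonempty by blast
  have "take ml (drop j (F (x n') @ T (x n'))) = take ml (F (x n))"
  proof (rule nth_equalityI)
    show "length (take ml (drop j (F (x n') @ T (x n')))) = length (take ml (F (x n)))"
      using marker_le[of "x n"] nj(2) by (simp add: tail_length)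
    fix i assume "i < length (take ml (drop j (F (x n') @ T (x n'))))"
    then have i: "i < ml" by simp
    have "F (x n) ! i = u (s n + i)"
      using i marker_le[of "x n"] image_word_nth[OF image, of i n] by simp
    also have "\<dots> = u (s n + i + p)" using i by (intro matchesD[OF assms]) auto
    also have "s n + i + p = s n' + (j + i)" using nj(1) by simp
    also have "u \<dots> = (F (x n') @ T (x n')) ! (j + i)"
      using i nj(2) by (intro u_nth) (simp add: tail_length)
    finally show "take ml (drop j (F (x n') @ T (x n'))) ! i = take ml (F (x n)) ! i"
      using i nj(2) by (simp add: tail_length del: drop_append take_append)
  qed
  then have "j = 0" using marker nj(2) by blast
  then show ?thesis using nj(1) by (metis add_0_right)
qed

text \<open>Letters equal in \<open>x\<close> at distance \<open>k\<close> have blocks of equal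
  length, so alignment passes along the run in both directions.\<close>

lemma aligned_run:
  assumes run: "matches x k a b" and al: "s (n + k) = s n + p" and n: "a \<le> n" "n \<le> b"
    and m: "a \<le> m" "m \<le> b"
  shows "s (m + k) = s m + p"
proof -
  have eqv: "s (Suc j + k) = s (Suc j) + p \<longleftrightarrow> s (j + k) = s j + p" if "a \<le> j" "j < b" for j
    using matchesD[OF run that] by (simp add: block_start_Suc)
  have *: "s (n + k) = s n + p \<longleftrightarrow> s (m + k) = s m + p" if "n \<le> m" "a \<le> n" "m \<le> b" for n m
    using that
  proof (induction m rule: dec_induct)
    case (step j)
    then show ?case using eqv[of j] by simp
  qed simp
  show ?thesis
    using *[of n m] *[of m n] al n m by (cases "n \<le> m") auto
qed

text \<open>A repetition reaching past the common prefix of the two unequal images would equate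
  letters at their first difference.\<close>

lemma right_bound:
  assumes al: "s (n + k) = s n + p" and ne: "x n \<noteq> x (n + k)" and mt: "matches u p i j" and "i \<le> s n"
  shows "j \<le> s n + pre (x n) (x (n + k))"
proof (rule ccontr)
  let ?l = "pre (x n) (x (n + k))"
  assume "\<not> ?thesis"
  then have "u (s n + ?l) = u (s n + ?l + p)"
    using assms(4) by (intro matchesD[OF mt]) auto
  also have "s n + ?l + p = s (n + k) + ?l" using al by simp
  finally show False
    using u_nth[of ?l n] u_nth[of ?l "n + k"] pre_less[OF ne] pre_mismatch[OF ne] by simp
qed

lemma left_bound:
  assumes al: "s (Suc n + k) = s (Suc n) + p" and ne: "x n \<noteq> x (n + k)" and mt: "matches u p i j"
    and "s (Suc n) \<le> j"
  shows "s (Suc n) \<le> i + suf (x n) (x (n + k))"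
proof (rule ccontr)
  let ?l = "suf (x n) (x (n + k))"
  assume neg: "\<not> ?thesis"
  then have "u (s (Suc n) - Suc ?l) = u (s (Suc n) - Suc ?l + p)"
    using assms(4) by (intro matchesD[OF mt]) auto
  also have "s (Suc n) - Suc ?l + p = s (Suc (n + k)) - Suc ?l" using al neg by simp
  finally show False
    using u_rev_nth[of ?l n] u_rev_nth[of ?l "n + k"] suf_less[OF ne] suf_mismatch[OF ne] by simp
qed

text \<open>Three zones match: the suffix shared by the images at the left mismatch, the run itself,
  and the prefix shared at the right mismatch. Together with the two bounds above this is the exact
  extent of the image repetition.\<close>

lemma full_match:
  assumes run: "matches x k (Suc q) e" and "q < e"
    and al: "s (Suc q + k) = s (Suc q) + p"
    and ne: "x q \<noteq> x (q + k)" "x e \<noteq> x (e + k)"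
  shows "matches u p (s (Suc q) - suf (x q) (x (q + k))) (s e + pre (x e) (x (e + k)))"
  unfolding matches_def
proof (intro allI impI, elim conjE)
  have al': "s (m + k) = s m + p" if "Suc q \<le> m" "m \<le> e" for m
    using aligned_run[OF run al] that assms(2) by simp
  fix t assume t: "s (Suc q) - suf (x q) (x (q + k)) \<le> t" "t < s e + pre (x e) (x (e + k))"
  consider "t < s (Suc q)" | "s (Suc q) \<le> t" "t < s e" | "s e \<le> t" by linarith
  then show "u t = u (t + p)"
  proof cases
    case 1
    define j where "j = s (Suc q) - Suc t"
    have j: "j < suf (x q) (x (q + k))" "t = s (Suc q) - Suc j" using 1 t(1) unfolding j_def by linarith+
    have "t + p = s (Suc (q + k)) - Suc j" using al 1 unfolding j_def by simp
    moreover have "rev (F (x q)) ! j = rev (F (x (q + k))) ! j"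
      using nth_less_lcp_length j(1) unfolding common_suffix_def by blast
    ultimately show ?thesis
      using u_rev_nth[of j q] u_rev_nth[of j "q + k"] suf_less[OF ne(1)] j by simp
  next
    case 2
    obtain m j where mj: "t = s m + j" "j < length (F (x m))"
      using image_word_position[of F t x] nonempty by blast
    have "m < e" using 2 mj s_mono[of e m] by linarith
    moreover have "Suc q \<le> m"
    proof (rule ccontr)
      assume "\<not> ?thesis"
      then have "s (Suc m) \<le> s (Suc q)" by (intro s_mono) simp
      then show False using mj 2 by (simp add: block_start_Suc)
    qed
    ultimately have "x m = x (m + k)" "s (m + k) = s m + p"
      using matchesD[OF run] al' by simp_all
    then show ?thesis
      using image_word_nth[OF image, of j m] image_word_nth[OF image, of j "m + k"] mj
      by (simp add: ac_simps)
  next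
    case 3
    define j where "j = t - s e"
    have j: "j < pre (x e) (x (e + k))" "t = s e + j" using 3 t unfolding j_def by linarith+
    have "t + p = s (e + k) + j" using al'[of e] j assms(2) by simp
    moreover have "u t = (F (x e) @ T (x e)) ! j" "u (s (e + k) + j) = (F (x (e + k)) @ T (x (e + k))) ! j"
      using u_nth[of j e] u_nth[of j "e + k"] pre_less[OF ne(2)] j by simp_all
    moreover have "(F (x e) @ T (x e)) ! j = (F (x (e + k)) @ T (x (e + k))) ! j"
      using nth_less_lcp_length j(1) unfolding common_prefix_def by blast
    ultimately show ?thesis by simp
  qed
qed

text \<open>The length bound puts a full marker at a block boundary inside the repetition;
  synchronisation there yields a period \<open>k\<close> in \<open>x\<close>. Extending the run both
  ways either gives a square of period \<open>k\<close> or meets a mismatch on each side.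
  \<open>far\<close> leaves room on the left.\<close>

lemma desubstitute:
  assumes mt: "matches u p i j" and p: "0 < p" and long: "i + max_len + ml \<le> j" and far: "s p \<le> i"
  obtains (square) k q where "0 < k" "k < p" "matches x k q (q + k)"
  | (run) k q e where "0 < k" "k < p" "q < e" "e \<le> q + k" "matches x k (Suc q) e"
      "x q \<noteq> x (q + k)" "x e \<noteq> x (e + k)"
      "s (Suc (q + k)) = s (Suc q) + p" "s (e + k) = s e + p"
      "s (Suc q) \<le> i + suf (x q) (x (q + k))" "j \<le> s e + pre (x e) (x (e + k))"
      "matches u p (s (Suc q) - suf (x q) (x (q + k))) (s e + pre (x e) (x (e + k)))"
proof (cases "\<exists>k q. 0 < k \<and> k < p \<and> matches x k q (q + k)")
  case True
  then show ?thesis using square by blast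
next
  case no_square: False
  obtain n where n: "i \<le> s n" "s n + ml \<le> j"
  proof -
    obtain m l where ml: "i = s m + l" "l < length (F (x m))"
      using image_word_position[of F i x] nonempty by blast
    have "i \<le> s (Suc m)" "s (Suc m) + ml \<le> j"
      using ml len_le[of "x m"] long by (simp_all add: block_start_Suc)
    then show ?thesis using that by blast
  qed
  have "matches u p (s n) (s n + ml)" using mt n by (auto simp: matches_def)
  then obtain n' where n': "s n' = s n + p" using synchronised by blast
  have "n < n'" using s_mono[of n' n] n' p by linarith
  then obtain k where k: "n' = n + k" "0 < k" by (metis less_imp_add_positive)
  have al: "s (n + k) = s n + p" using n' k by simp
  \<comment> \<open>Blocks have length at least 2, so \<open>p\<close> is at least
    \<open>2 * k\<close>.\<close>
  have "k < p" using s_ge[of n k] al k by linarith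
  have "p \<le> n" using far n(1) s_less[of n p] by linarith
  have ex_right: "\<exists>t\<ge>n. x t \<noteq> x (t + k)"
  proof (rule ccontr)
    assume "\<not> ?thesis"
    then show False using no_square k(2) \<open>k < p\<close> unfolding matches_def by blast
  qed
  have ex_left: "\<exists>t<n. x t \<noteq> x (t + k)"
  proof (rule ccontr)
    assume "\<not> ?thesis"
    moreover have "n - k + k = n" using \<open>k < p\<close> \<open>p \<le> n\<close> by simp
    ultimately have "matches x k (n - k) (n - k + k)" unfolding matches_def by metis
    then show False using no_square k(2) \<open>k < p\<close> by blast
  qed
  define e where "e = (LEAST t. n \<le> t \<and> x t \<noteq> x (t + k))"
  define q where "q = (GREATEST t. t < n \<and> x t \<noteq> x (t + k))"
  have "n \<le> e \<and> x e \<noteq> x (e + k)"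
    unfolding e_def by (rule LeastI_ex[OF ex_right])
  then have e: "n \<le> e" "x e \<noteq> x (e + k)" by simp_all
  have "q < n \<and> x q \<noteq> x (q + k)"
    unfolding q_def by (rule GreatestI_ex_nat[OF ex_left, of n]) simp
  then have q: "q < n" "x q \<noteq> x (q + k)" by simp_all
  have run: "matches x k (Suc q) e"
    unfolding matches_def
  proof (intro allI impI, rule ccontr)
    fix t assume t: "Suc q \<le> t \<and> t < e" "x t \<noteq> x (t + k)"
    show False
    proof (cases "n \<le> t")
      case True
      then show False using t Least_le[of "\<lambda>t. n \<le> t \<and> x t \<noteq> x (t + k)" t] unfolding e_def by simp
    next
      case False
      then have "t \<le> q" unfolding q_def using t by (intro Greatest_le_nat[of _ _ n]) auto
      then show False using t by simp
    qed
  qed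
  have "e \<le> q + k"
  proof (rule ccontr)
    assume "\<not> ?thesis"
    then have "matches x k (Suc q) (Suc q + k)" 
      using run unfolding matches_def by (metis add_Suc less_le_trans not_less_eq_eq)
    then show False using no_square k(2) \<open>k < p\<close> by blast
  qed
  have al': "s (m + k) = s m + p" if "Suc q \<le> m" "m \<le> e" for m
    using aligned_run[OF run al] q e that by simp
  have alq: "s (Suc q + k) = s (Suc q) + p" and ale: "s (e + k) = s e + p"
    using al'[of "Suc q"] al'[of e] q e by simp_all
  have "i \<le> s e" using n(1) s_mono[OF e(1)] by simp
  have "s (Suc q) \<le> j" using n(2) s_mono[of "Suc q" n] q by simp
  show ?thesis
  proof (rule that(2)[OF k(2) \<open>k < p\<close> _ \<open>e \<le> q + k\<close> run q(2) e(2)])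
    show "q < e" using q e by simp
    then show "matches u p (s (Suc q) - suf (x q) (x (q + k))) (s e + pre (x e) (x (e + k)))"
      by (intro full_match[OF run _ alq q(2) e(2)])
    show "s (Suc (q + k)) = s (Suc q) + p" using alq by simp
    show "s (e + k) = s e + p" by (rule ale)
    show "s (Suc q) \<le> i + suf (x q) (x (q + k))"
      by (rule left_bound[OF alq q(2) mt \<open>s (Suc q) \<le> j\<close>])
    show "j \<le> s e + pre (x e) (x (e + k))"
      by (rule right_bound[OF ale e(2) mt \<open>i \<le> s e\<close>])
  qed
qed

end

subsection \<open>The morphisms and their words\<close>

datatype letter = A | B | K | L | M | N

definition letters :: "letter list" where "letters = [A, B, K, L, M, N]"

lemma in_letters [simp]: "c \<in> set letters"
  by (cases c) (simp_all add: letters_def)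

text \<open>Badkobeh and Crochemore use the morphism
  a \<open>\<rightarrow>\<close> abac, b \<open>\<rightarrow>\<close> babd, c \<open>\<rightarrow>\<close> eabdf, d \<open>\<rightarrow>\<close> fbace, e \<open>\<rightarrow>\<close> bace, f \<open>\<rightarrow>\<close> abdf. In its fixed
  point c, d, e, f are always preceded by a, b, ac, bd. Here the groups ac, bd, ace, bdf are the
  letters \<open>K\<close>, \<open>L\<close>, \<open>M\<close>, \<open>N\<close>; after this regrouping an adjacent pair from \<open>{A, B}\<close> occurs
  exactly at the start of each block.\<close>

fun G :: "letter \<Rightarrow> letter list" where
  "G A = [A, B, K]"
| "G B = [B, A, L]"
| "G K = [A, B, M, A, N]"
| "G L = [B, A, N, B, M]"
| "G M = [A, B, M, A, N, B, M]"
| "G N = [B, A, N, B, M, A, N]"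

fun H :: "letter \<Rightarrow> nat list" where
  "H A = [1,0,0,1,1]"
| "H B = [0,1,1,0,0]"
| "H K = [1,0,0,1,1,0,1,0,0,1]"
| "H L = [0,1,1,0,0,1,0,1,1,0]"
| "H M = [1,0,0,1,1,0,1,0,0,1,0,1,1,0]"
| "H N = [0,1,1,0,0,1,0,1,1,0,1,0,0,1]"

text \<open>All possible successors of a letter have \<open>G\<close>-images with the same first two
  letters and \<open>H\<close>-images with the same first five; \<open>A\<close> or \<open>B\<close>
  serves as their representative.\<close>

fun next_start :: "letter \<Rightarrow> letter" where
  "next_start A = B"
| "next_start B = A"
| "next_start K = B"
| "next_start L = A"
| "next_start M = A"
| "next_start N = B"

definition G_tail :: "letter \<Rightarrow> letter list" where
  "G_tail c = take 2 (G (next_start c))"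

definition H_tail :: "letter \<Rightarrow> nat list" where
  "H_tail c = H (next_start c)"

text \<open>Contains every pair inside a block of \<open>G\<close> and is preserved across block
  boundaries, so it bounds the pairs that the finite checks must cover.\<close>

definition adjacent :: "(letter \<times> letter) list" where
  "adjacent = [(K,B), (L,A), (M,A), (N,B), (A,L), (A,N), (A,B), (B,K), (B,M), (B,A)]"

interpretation G: marked_code G G_tail 2 7
proof
  fix c d :: letter and j :: nat
  show "length (G_tail c) = 2" by (cases c) (simp_all add: G_tail_def)
  show "2 \<le> length (G c)" "length (G c) \<le> 7" by (cases c; simp)+
  have "\<forall>c\<in>set letters. \<forall>d\<in>set letters. \<forall>j\<in>set [0..<length (G c)].
      take 2 (drop j (G c @ G_tail c)) = take 2 (G d) \<longrightarrow> j = 0"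
    by code_simp
  then show "j < length (G c) \<Longrightarrow> take 2 (drop j (G c @ G_tail c)) = take 2 (G d) \<Longrightarrow> j = 0"
    by simp
  have "\<forall>c\<in>set letters. \<forall>d\<in>set letters. c \<noteq> d \<longrightarrow>
      lcp_length (G c @ G_tail c) (G d @ G_tail d) < length (G c @ G_tail c) \<and>
      lcp_length (rev (G c)) (rev (G d)) < length (G c)"
    by code_simp
  then show "c \<noteq> d \<Longrightarrow> lcp_length (G c @ G_tail c) (G d @ G_tail d) < length (G c @ G_tail c)"
    "c \<noteq> d \<Longrightarrow> lcp_length (rev (G c)) (rev (G d)) < length (G c)"
    by simp_all
qed

interpretation H: marked_code H H_tail 5 14
proof
  fix c d :: letter and j :: nat
  show "length (H_tail c) = 5" by (cases c) (simp_all add: H_tail_def)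
  show "2 \<le> length (H c)" "length (H c) \<le> 14" "5 \<le> length (H c)" by (cases c; simp)+
  have "\<forall>c\<in>set letters. \<forall>d\<in>set letters. \<forall>j\<in>set [0..<length (H c)].
      take 5 (drop j (H c @ H_tail c)) = take 5 (H d) \<longrightarrow> j = 0"
    by code_simp
  then show "j < length (H c) \<Longrightarrow> take 5 (drop j (H c @ H_tail c)) = take 5 (H d) \<Longrightarrow> j = 0"
    by simp
  have "\<forall>c\<in>set letters. \<forall>d\<in>set letters. c \<noteq> d \<longrightarrow>
      lcp_length (H c @ H_tail c) (H d @ H_tail d) < length (H c @ H_tail c) \<and>
      lcp_length (rev (H c)) (rev (H d)) < length (H c)"
    by code_simp
  then show "c \<noteq> d \<Longrightarrow> lcp_length (H c @ H_tail c) (H d @ H_tail d) < length (H c @ H_tail c)"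
    "c \<noteq> d \<Longrightarrow> lcp_length (rev (H c)) (rev (H d)) < length (H c)"
    by simp_all
qed

lemma G_nonempty: "G c \<noteq> []" by (cases c) simp_all
lemma H_nonempty: "H c \<noteq> []" by (cases c) simp_all

section \<open>Iterates of \<open>G\<close> and its fixed point\<close>

definition G_iter :: "nat \<Rightarrow> letter list \<Rightarrow> letter list" where
  "G_iter n = ((\<lambda>v. concat (map G v)) ^^ n)"

lemma G_iter_append: "G_iter n (v @ v') = G_iter n v @ G_iter n v'"
  unfolding G_iter_def by (induction n) simp_all

lemma G_iter_Suc: "G_iter (Suc n) v = concat (map G (G_iter n v))"
  unfolding G_iter_def by simp

lemma G_iter_nonempty: "v \<noteq> [] \<Longrightarrow> G_iter n v \<noteq> []"
proof (induction n)
  case (Suc n)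
  then show ?case unfolding G_iter_Suc by (cases "G_iter n v") (simp_all add: G_nonempty)
qed (simp add: G_iter_def)

lemma G_iter_Suc': "G_iter (Suc n) v = G_iter n (concat (map G v))"
  unfolding G_iter_def by (simp only: funpow_Suc_right o_apply)

text \<open>\<open>G A\<close> begins with \<open>A\<close>, so the iterates on \<open>A\<close> are
  nested prefixes of one infinite word.\<close>

lemma G_iter_prefix: "\<exists>v. G_iter (Suc n) [A] = G_iter n [A] @ v \<and> v \<noteq> []"
  using G_iter_append[of n "[A]" "[B, K]"] G_iter_nonempty[of "[B, K]" n] by (simp add: G_iter_Suc')

lemma G_iter_length: "n < length (G_iter n [A])"
proof (induction n)
  case 0
  then show ?case by (simp add: G_iter_def)
next
  case (Suc n)
  obtain v where "G_iter (Suc n) [A] = G_iter n [A] @ v" "v \<noteq> []" using G_iter_prefix by blast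
  then show ?case using Suc by (cases v) auto
qed

definition core :: "letter word" where
  "core n = G_iter n [A] ! n"

lemma G_iter_nth_mono:
  assumes "m \<le> n" "t < length (G_iter m [A])"
  shows "t < length (G_iter n [A])" "G_iter n [A] ! t = G_iter m [A] ! t"
proof -
  have "t < length (G_iter n [A]) \<and> G_iter n [A] ! t = G_iter m [A] ! t"
    using assms(1)
  proof (induction n rule: dec_induct)
    case base
    then show ?case using assms(2) by simp
  next
    case (step n)
    obtain v where "G_iter (Suc n) [A] = G_iter n [A] @ v" using G_iter_prefix by blast
    then show ?case using step.IH by (simp add: nth_append)
  qed
  then show "t < length (G_iter n [A])" "G_iter n [A] ! t = G_iter m [A] ! t" by simp_all
qed

lemma core_eq_nth: "t < length (G_iter n [A]) \<Longrightarrow> core t = G_iter n [A] ! t"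
  unfolding core_def
  using G_iter_nth_mono(2)[of n t t] G_iter_nth_mono(2)[of t n t] G_iter_length[of t]
  by (cases "n \<le> t") auto

lemma core_fixed: "image_word G core core"
  unfolding image_word_def
proof
  fix n
  have "take n (G_iter n [A]) = map core [0..<n]"
    by (rule nth_equalityI) (use G_iter_length[of n] core_eq_nth[of _ n] in auto)
  then obtain v where v: "G_iter n [A] = map core [0..<n] @ v"
    by (metis append_take_drop_id)
  have "concat (map G (map core [0..<n])) @ concat (map G v) = G_iter (Suc n) [A]"
    unfolding G_iter_Suc v by simp
  then have "t < block_start G core n \<Longrightarrow> concat (map G (map core [0..<n])) ! t = core t" for t
    using core_eq_nth[of t "Suc n"]
    by (metis block_start_def length_append nth_append trans_less_add1)
  then show "concat (map G (map core [0..<n])) = map core [0..<block_start G core n]"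
    by (intro nth_equalityI) (auto simp: block_start_def)
qed

text \<open>A pair lies inside a block or straddles the blocks of a pair occurring earlier, so
  strong induction on the position applies.\<close>

lemma core_adjacent: "(core t, core (Suc t)) \<in> set adjacent"
proof (induction t rule: less_induct)
  case (less t)
  obtain n j where nj: "t = block_start G core n + j" "j < length (G (core n))"
    using image_word_position[of G t core] G_nonempty by blast
  have t: "core t = G (core n) ! j" using image_word_nth[OF core_fixed nj(2)] nj(1) by simp
  show ?case
  proof (cases "Suc j < length (G (core n))")
    case True
    have "core (Suc t) = G (core n) ! Suc j"
      using image_word_nth[OF core_fixed True] nj(1) by simp
    moreover have "\<forall>c\<in>set letters. \<forall>j\<in>set [0..<length (G c)]. Suc j < length (G c) \<longrightarrow>
        (G c ! j, G c ! Suc j) \<in> set adjacent"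
      by code_simp
    ultimately show ?thesis using t nj(2) True by simp
  next
    case False
    have "3 \<le> length (G c)" for c by (cases c) simp_all
    from this[of "core n"] have "n < t"
      using nj False block_start_ge[of G core 0 n] G_nonempty by simp
    then have "(core n, core (Suc n)) \<in> set adjacent" by (rule less)
    moreover have "\<forall>(c, d)\<in>set adjacent. (G c ! (length (G c) - 1), G d ! 0) \<in> set adjacent"
      by code_simp
    moreover have "core (Suc t) = G (core (Suc n)) ! 0"
    proof -
      have "Suc t = block_start G core (Suc n) + 0" using nj False by (simp add: block_start_Suc)
      then show ?thesis using image_word_nth[OF core_fixed, of 0 "Suc n"] G_nonempty by simp
    qed
    moreover have "j = length (G (core n)) - 1" using nj False by simp
    ultimately show ?thesis using t by auto
  qed
qed

text \<open>The first letter recurs at distance 4, and applying \<open>G\<close> at least doubles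
  both the length of a repeated prefix and its distance.\<close>

lemma core_recurrent: "recurrent core"
proof -
  have ex: "\<exists>n d. b \<le> n \<and> b \<le> d \<and> 0 < n \<and> 0 < d \<and> (\<forall>t<n. core (t + d) = core t)" for b
  proof (induction b)
    case 0
    have "core 0 = A" "core 4 = A"
      using core_eq_nth[of 0 2] core_eq_nth[of 4 2] by (simp_all add: G_iter_def numeral_2_eq_2)
    then show ?case by (intro exI[of _ 1] exI[of _ 4]) simp
  next
    case (Suc b)
    then obtain n d where nd: "b \<le> n" "b \<le> d" "0 < n" "0 < d" "\<forall>t<n. core (t + d) = core t" by blast
    have "block_start G core m \<ge> 2 * m" for m
    proof (induction m)
      case (Suc m)
      then show ?case using G.len_ge[of "core m"] by (simp add: block_start_Suc)
    qed simp
    then have "Suc b \<le> block_start G core n" "Suc b \<le> block_start G core d"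
      using nd(1-4) by (metis Suc_leI le_trans mult_2 less_add_same_cancel1 less_le_trans le_less_trans)+
    moreover have "\<forall>t<block_start G core n. core (t + block_start G core d) = core t"
      using image_word_shift[OF G_nonempty core_fixed nd(5)] by blast
    ultimately show ?case by (metis Suc_le_lessD gr_zeroI less_zeroE)
  qed
  show ?thesis
    unfolding recurrent_def
  proof (intro allI)
    fix n b :: nat
    obtain n' d where "max n b \<le> n'" "max n b \<le> d" "\<forall>t<n'. core (t + d) = core t"
      using ex[of "max n b"] by blast
    then show "\<exists>d\<ge>b. \<forall>t<n. core (t + d) = core t" by (intro exI[of _ d]) auto
  qed
qed

definition bin :: "nat word" where "bin = image_of H core"

lemma bin_image: "image_word H core bin"
  unfolding bin_def using H_nonempty by (rule image_word_image_of)

lemma follow_facts: "take 2 (G (core (Suc n))) = G_tail (core n)" "take 5 (H (core (Suc n))) = H_tail (core n)"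
proof -
  have "\<forall>(c, d)\<in>set adjacent. take 2 (G d) = G_tail c \<and> take 5 (H d) = H_tail c" by code_simp
  then show "take 2 (G (core (Suc n))) = G_tail (core n)" "take 5 (H (core (Suc n))) = H_tail (core n)"
    using core_adjacent[of n] by auto
qed

interpretation G: marked_image G G_tail 2 7 core core
  by unfold_locales (simp_all add: core_fixed follow_facts)

interpretation H: marked_image H H_tail 5 14 core bin
  by unfold_locales (simp_all add: bin_image follow_facts)

subsection \<open>Repetitions in the fixed point\<close>

text \<open>Consider a maximal repetition of period \<open>k\<close> whose left mismatch is between \<open>a\<close> and \<open>b\<close> (\<open>k\<close>
  positions further) and whose right mismatch is between \<open>b'\<close> and \<open>c\<close>. If it falls short of a square
  by one letter, then \<open>b\<close> and \<open>b'\<close> are the same occurrence; if by two letters, they are adjacent.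
  \<open>step_ok\<close> describes the repetition generated in the image under \<open>G\<close>, where \<open>n\<close> is the length of the
  image of the missing letters.\<close>

definition one_defect_pos :: "letter \<Rightarrow> letter \<Rightarrow> letter \<Rightarrow> bool" where
  "one_defect_pos a b c \<longleftrightarrow> common_suffix H a b + common_prefix H H_tail b c < length (H b)"

definition two_defect_pos :: "letter \<Rightarrow> letter \<Rightarrow> letter \<Rightarrow> letter \<Rightarrow> bool" where
  "two_defect_pos a b b' c \<longleftrightarrow> common_suffix H a b + common_prefix H H_tail b' c < length (H b') + length (H b)"

definition step_ok :: "letter \<Rightarrow> letter \<Rightarrow> letter \<Rightarrow> letter \<Rightarrow> nat \<Rightarrow> bool" where
  "step_ok a b b' c n \<longleftrightarrow>
    (let f = common_suffix G a b; g = common_prefix G G_tail b' c;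
      a1 = rev (G a) ! f; b1 = rev (G b) ! f; b2 = (G b' @ G_tail b') ! g; c2 = (G c @ G_tail c) ! g
    in f + g < n \<and> (n = f + g + 1 \<longrightarrow> b1 = b2 \<longrightarrow> one_defect_pos a1 b1 c2) \<and>
       (n = f + g + 2 \<longrightarrow> two_defect_pos a1 b1 b2 c2))"

lemma step_ok_one: "\<forall>a\<in>set letters. \<forall>b\<in>set letters. \<forall>c\<in>set letters. a \<noteq> b \<longrightarrow> b \<noteq> c \<longrightarrow> one_defect_pos a b c \<longrightarrow>
    step_ok a b b c (length (G b))"
  by code_simp

lemma step_ok_two: "\<forall>(b', b)\<in>set adjacent. \<forall>a\<in>set letters. \<forall>c\<in>set letters. a \<noteq> b \<longrightarrow> b' \<noteq> c \<longrightarrow> two_defect_pos a b b' c \<longrightarrow>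
    step_ok a b b' c (length (G b') + length (G b))"
  by code_simp

text \<open>An image repetition generated by the run has period
  \<open>H.s (Suc (q + k)) - H.s (Suc q)\<close> and matches from \<open>H.s (Suc q)\<close> minus
  the common suffix up to \<open>H.s e\<close> plus the common prefix. The inequality says that this
  is less than one period, so no square arises.\<close>

definition defects_pos :: "nat \<Rightarrow> bool" where
  "defects_pos k \<longleftrightarrow> (\<forall>q. \<not> matches core k q (q + k)) \<and>
    (\<forall>q e. q < e \<longrightarrow> e \<le> q + k \<longrightarrow> matches core k (Suc q) e \<longrightarrow>
      core q \<noteq> core (q + k) \<longrightarrow> core e \<noteq> core (e + k) \<longrightarrow>
      H.s e + H.suf (core q) (core (q + k)) + H.pre (core e) (core (e + k)) < H.s (Suc (q + k)))"

text \<open>Applied when at least three letters are missing: a whole block, of length at least 3 for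
  \<open>G\<close> and 5 for \<open>H\<close>, then lies between those of \<open>b'\<close> and
  \<open>b\<close>. The slack 2 in the first bound makes the last two clauses of
  \<open>step_ok\<close> vacuous.\<close>

lemma gap_bounds:
  assumes "a \<noteq> b" "b' \<noteq> c"
  shows "G.suf a b + G.pre b' c + 2 < length (G b') + 3 + length (G b)"
    and "H.suf a b + H.pre b' c < length (H b') + 5 + length (H b)"
proof -
  have "\<forall>a\<in>set letters. \<forall>b\<in>set letters. a \<noteq> b \<longrightarrow>
      Suc (G.suf a b) \<le> length (G b) \<and> G.pre a b \<le> length (G a) + 1 \<and>
      H.suf a b + 2 \<le> length (H b) \<and> H.pre a b \<le> length (H a) + 4"
    by code_simp
  then have "Suc (G.suf a b) \<le> length (G b)" "G.pre b' c \<le> length (G b') + 1"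
      "H.suf a b + 2 \<le> length (H b)" "H.pre b' c \<le> length (H b') + 4"
    using assms by simp_all
  then show "G.suf a b + G.pre b' c + 2 < length (G b') + 3 + length (G b)"
    "H.suf a b + H.pre b' c < length (H b') + 5 + length (H b)"
    by simp_all
qed

lemma s_far:
  assumes "Suc e < m"
  shows "G.s e + (length (G (core e)) + 3 + length (G (core m))) \<le> G.s (Suc m)"
    and "H.s e + (length (H (core e)) + 5 + length (H (core m))) \<le> H.s (Suc m)"
proof -
  have "3 \<le> length (G c)" "5 \<le> length (H c)" for c by (cases c; simp)+
  then show "G.s e + (length (G (core e)) + 3 + length (G (core m))) \<le> G.s (Suc m)"
    "H.s e + (length (H (core e)) + 5 + length (H (core m))) \<le> H.s (Suc m)"
    using G.s_mono[of "Suc (Suc e)" m] H.s_mono[of "Suc (Suc e)" m] assms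
    by (simp_all add: block_start_Suc) (smt (verit) add.assoc add_le_mono le_trans nat_add_left_cancel_le)+
qed

lemma defect_one_iff:
  "e = q + k \<Longrightarrow> H.s e + H.suf (core q) (core (q + k)) + H.pre (core e) (core (e + k)) < H.s (Suc (q + k)) \<longleftrightarrow>
    one_defect_pos (core q) (core (q + k)) (core (e + k))"
  unfolding one_defect_pos_def by (simp add: block_start_Suc)

lemma defect_two_iff:
  assumes "Suc e = q + k"
  shows "H.s e + H.suf (core q) (core (q + k)) + H.pre (core e) (core (e + k)) < H.s (Suc (q + k)) \<longleftrightarrow>
    two_defect_pos (core q) (core (q + k)) (core e) (core (e + k))"
  unfolding assms[symmetric] two_defect_pos_def by (simp add: block_start_Suc)

lemma defect_large:
  assumes "Suc e < q + k" "core q \<noteq> core (q + k)" "core e \<noteq> core (e + k)"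
  shows "H.s e + H.suf (core q) (core (q + k)) + H.pre (core e) (core (e + k)) < H.s (Suc (q + k))"
  using s_far(2)[OF assms(1)] gap_bounds(2)[OF assms(2,3)] by linarith

lemma run_step_ok:
  assumes "defects_pos k" "q < e" "e \<le> q + k" "matches core k (Suc q) e"
    "core q \<noteq> core (q + k)" "core e \<noteq> core (e + k)"
  shows "step_ok (core q) (core (q + k)) (core e) (core (e + k)) (G.s (Suc (q + k)) - G.s e)"
proof -
  have *: "H.s e + H.suf (core q) (core (q + k)) + H.pre (core e) (core (e + k)) < H.s (Suc (q + k))"
    using assms unfolding defects_pos_def by blast
  consider "e = q + k" | "Suc e = q + k" | "Suc e < q + k" using assms(3) by linarith
  then show ?thesis
  proof cases
    case 1
    then have "G.s (Suc (q + k)) - G.s e = length (G (core (q + k)))" by (simp add: block_start_Suc)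
    then show ?thesis using step_ok_one * defect_one_iff[OF 1] assms(5,6) 1 by simp
  next
    case 2
    then have "G.s (Suc (q + k)) - G.s e = length (G (core e)) + length (G (core (q + k)))"
      by (simp add: block_start_Suc flip: 2)
    moreover have "(core e, core (q + k)) \<in> set adjacent" using core_adjacent[of e] 2 by simp
    ultimately show ?thesis using step_ok_two * defect_two_iff[OF 2] assms(5,6) by fastforce
  next
    case 3
    then show ?thesis
      using s_far(1)[OF 3] gap_bounds(1)[OF assms(5,6)] unfolding step_ok_def Let_def by auto
  qed
qed

text \<open>The bound 9 is the longest block plus the marker, \<open>7 + 2\<close>. A square, moved
  far enough right by recurrence, comes from a square or a run of smaller period: the former is
  excluded by \<open>defects_pos\<close>, and the latter generates fewer than \<open>p\<close>
  matching positions by \<open>step_ok\<close>.\<close>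

lemma no_large_square:
  assumes IH: "\<And>k. 0 < k \<Longrightarrow> k < p \<Longrightarrow> defects_pos k" and p: "9 \<le> p"
  shows "\<not> matches core p q (q + p)"
proof
  assume mt: "matches core p q (q + p)"
  obtain d where d: "d \<ge> G.s p" "\<forall>t<q + p + p. core (t + d) = core t"
    using core_recurrent unfolding recurrent_def by blast
  have "matches core p (q + d) (q + p + d)" using matches_shift[OF d(2) _ mt] by simp
  moreover have "0 < p" "q + d + 7 + 2 \<le> q + p + d" "G.s p \<le> q + d" using p d by simp_all
  ultimately show False
  proof (rule G.desubstitute)
    fix k q' assume "0 < k" "k < p" "matches core k q' (q' + k)"
    then show False using IH unfolding defects_pos_def by blast
  next
    fix k q' e assume *: "0 < k" "k < p" "q' < e" "e \<le> q' + k" "matches core k (Suc q') e"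
      "core q' \<noteq> core (q' + k)" "core e \<noteq> core (e + k)"
      "G.s (Suc (q' + k)) = G.s (Suc q') + p"
      "G.s (Suc q') \<le> q + d + G.suf (core q') (core (q' + k))"
      "q + p + d \<le> G.s e + G.pre (core e) (core (e + k))"
    have "step_ok (core q') (core (q' + k)) (core e) (core (e + k)) (G.s (Suc (q' + k)) - G.s e)"
      using run_step_ok[OF IH] * by blast
    then have "G.suf (core q') (core (q' + k)) + G.pre (core e) (core (e + k)) < G.s (Suc (q' + k)) - G.s e"
      unfolding step_ok_def Let_def by blast
    then show False using *(8-10) by linarith
  qed
qed

text \<open>Only runs missing at most two letters need desubstitution; they match at least
  \<open>p - 2\<close> positions, which is at least 9. By maximality such a run is exactly the one
  generated by a run of smaller period, so \<open>step_ok\<close> applies to its boundary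
  letters.\<close>

lemma defects_pos_step:
  assumes IH: "\<And>k. 0 < k \<Longrightarrow> k < p \<Longrightarrow> defects_pos k" and p: "11 \<le> p"
  shows "defects_pos p"
  unfolding defects_pos_def
proof (intro conjI allI impI)
  show "\<not> matches core p q (q + p)" for q using no_large_square[OF IH] p by simp
next
  fix q e assume qe: "q < e" "e \<le> q + p" "matches core p (Suc q) e"
    and ne: "core q \<noteq> core (q + p)" "core e \<noteq> core (e + p)"
  show "H.s e + H.suf (core q) (core (q + p)) + H.pre (core e) (core (e + p)) < H.s (Suc (q + p))"
  proof (cases "Suc e < q + p")
    case True
    then show ?thesis using defect_large ne by blast
  next
    case False
    obtain d where d: "d \<ge> G.s p" "\<forall>t<Suc (e + p). core (t + d) = core t"
      using core_recurrent unfolding recurrent_def by blast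
    have eqs: "core (q + d) = core q" "core (q + p + d) = core (q + p)"
      "core (e + d) = core e" "core (e + p + d) = core (e + p)"
      using d(2) qe(1) by simp_all
    have "matches core p (Suc q + d) (e + d)" using matches_shift[OF d(2) _ qe(3)] by simp
    moreover have "0 < p" "Suc q + d + 7 + 2 \<le> e + d" "G.s p \<le> Suc q + d" using p d False by simp_all
    ultimately show ?thesis
    proof (rule G.desubstitute)
      fix k q' assume "0 < k" "k < p" "matches core k q' (q' + k)"
      then show ?thesis using IH unfolding defects_pos_def by blast
    next
      fix k q' e'
      let ?f = "G.suf (core q') (core (q' + k))" and ?g = "G.pre (core e') (core (e' + k))"
      assume *: "0 < k" "k < p" "q' < e'" "e' \<le> q' + k" "matches core k (Suc q') e'"
        and ne': "core q' \<noteq> core (q' + k)" "core e' \<noteq> core (e' + k)"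
        and al: "G.s (Suc (q' + k)) = G.s (Suc q') + p" "G.s (e' + k) = G.s e' + p"
        and le: "G.s (Suc q') \<le> Suc q + d + ?f" "e + d \<le> G.s e' + ?g"
        and full: "matches core p (G.s (Suc q') - ?f) (G.s e' + ?g)"
      have ok: "step_ok (core q') (core (q' + k)) (core e') (core (e' + k)) (G.s (Suc (q' + k)) - G.s e')"
        using run_step_ok[OF IH] * ne' by blast
      \<comment> \<open>If the generated repetition began further left, it would cover the mismatch
        at \<open>q + d\<close>.\<close>
      have left: "G.s (Suc q') = Suc (q + d) + ?f"
      proof (rule ccontr)
        assume "\<not> ?thesis"
        then have "G.s (Suc q') - ?f \<le> q + d" using le(1) by linarith
        then have "core (q + d) = core (q + d + p)" using le(2) qe(1) by (intro matchesD[OF full]) auto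
        then show False using eqs ne by (simp add: ac_simps)
      qed
      have right: "e + d = G.s e' + ?g"
      proof (rule ccontr)
        assume "\<not> ?thesis"
        then have "core (e + d) = core (e + d + p)" using le qe(1) by (intro matchesD[OF full]) auto
        then show False using eqs ne by (simp add: ac_simps)
      qed
      \<comment> \<open>The image of the letters missing from the old run, cut down by the agreement
        on both sides, leaves the letters missing from the new one.\<close>
      have n: "G.s (Suc (q' + k)) - G.s e' = ?f + ?g + (Suc (q + p) - e)"
        using al(1) left right qe by linarith
      have "core q = rev (G (core q')) ! ?f"
        using G.u_rev_nth[OF G.suf_less(1)[OF ne'(1)]] left eqs(1) by simp
      moreover have "core (q + p) = rev (G (core (q' + k))) ! ?f"
      proof -
        have "q + p + d = G.s (Suc (q' + k)) - Suc ?f" using al(1) left by simp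
        then show ?thesis using G.u_rev_nth[OF G.suf_less(2)[OF ne'(1)]] eqs(2) by simp
      qed
      moreover have "core e = (G (core e') @ G_tail (core e')) ! ?g"
        using G.u_nth[OF G.pre_less(1)[OF ne'(2)]] right eqs(3) by simp
      moreover have "core (e + p) = (G (core (e' + k)) @ G_tail (core (e' + k))) ! ?g"
      proof -
        have "e + p + d = G.s (e' + k) + ?g" using al(2) right by simp
        then show ?thesis using G.u_nth[OF G.pre_less(2)[OF ne'(2)]] eqs(4) by simp
      qed
      ultimately have ok': "(Suc (q + p) - e = 1 \<longrightarrow> core (q + p) = core e \<longrightarrow> one_defect_pos (core q) (core (q + p)) (core (e + p))) \<and>
          (Suc (q + p) - e = 2 \<longrightarrow> two_defect_pos (core q) (core (q + p)) (core e) (core (e + p)))"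
        using ok unfolding step_ok_def Let_def n by simp
      consider "e = q + p" | "Suc e = q + p" using False qe(2) by linarith
      then show ?thesis
      proof cases
        case 1
        then show ?thesis using ok' defect_one_iff[OF 1] by simp
      next
        case 2
        moreover have "Suc (q + p) - e = 2" using 2 by simp
        ultimately show ?thesis using ok' defect_two_iff[OF 2] by blast
      qed
    qed
  qed
qed

section \<open>Small periods of the fixed point, by evaluation on windows\<close>

fun all_shifts :: "(nat \<Rightarrow> 'a list \<Rightarrow> bool) \<Rightarrow> nat \<Rightarrow> nat \<Rightarrow> 'a list \<Rightarrow> bool" where
  "all_shifts Q p 0 t = True"
| "all_shifts Q p (Suc n) t = (Q p t \<and> all_shifts Q (Suc p) n (tl t))"

lemma all_shifts_iff: "all_shifts Q p n t \<longleftrightarrow> (\<forall>j<n. Q (p + j) (drop j t))"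
proof (induction Q p n t rule: all_shifts.induct)
  case (2 Q p n t)
  have "(\<forall>j<Suc n. Q (p + j) (drop j t)) \<longleftrightarrow> Q p t \<and> (\<forall>j<n. Q (p + Suc j) (drop (Suc j) t))"
    by (simp only: All_less_Suc2) simp
  then show ?case using 2 by (simp add: drop_Suc)
qed simp

definition "G2 c = concat (map G (G c))"
definition "G3 c = concat (map G (G2 c))"

text \<open>\<open>r\<close> is a window starting at a candidate left mismatch \<open>q\<close>, and
  \<open>t\<close> is \<open>r\<close> without its first \<open>p\<close> letters. The first clause
  excludes squares at \<open>q\<close> and \<open>q + 1\<close> and treats one missing letter, the
  second treats two; there \<open>p = 1\<close> is exempt because it would force
  \<open>e = q\<close>.\<close>

definition shift_ok :: "letter list \<Rightarrow> nat \<Rightarrow> letter list \<Rightarrow> bool" where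
  "shift_ok r p t \<longleftrightarrow>
    (if p \<le> Suc (Suc (lcp_length (tl r) (tl t))) then
       (if p \<le> Suc (lcp_length (tl r) (tl t))
        then hd r \<noteq> hd t \<and> hd t \<noteq> t ! p \<and> one_defect_pos (hd r) (hd t) (t ! p) else True) \<and>
       (hd r = hd t \<or> p = 1 \<or> r ! (p - 1) = t ! (p - 1) \<or>
         two_defect_pos (hd r) (hd t) (r ! (p - 1)) (t ! (p - 1)))
     else True)"

text \<open>Periods up to 10 concern the letters from \<open>q\<close> to \<open>q + 2 * p\<close>,
  hence windows of length 21; the blocks of \<open>G3\<close> are at least that long.\<close>

lemma shift_ok_blocks: "\<forall>(c, d)\<in>set adjacent. all_shifts (\<lambda>_ r. all_shifts (shift_ok (take 21 r)) 1 10 (tl (take 21 r))) 0 (length (G3 c)) (G3 c @ G3 d)"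
  by code_simp

lemma image_G2: "image_word G2 core core"
  using image_word_comp[OF core_fixed core_fixed] unfolding G2_def .

lemma image_G3: "image_word G3 core core"
  using image_word_comp[OF image_G2 core_fixed] unfolding G3_def .

lemma defects_pos_small:
  assumes p: "0 < p" "p < 11"
  shows "defects_pos p"
proof -
  have len: "21 \<le> length (G3 c)" for c
  proof -
    have "\<forall>c\<in>set letters. 21 \<le> length (G3 c)" by code_simp
    then show ?thesis by simp
  qed
  have window: "\<exists>r. length r = 21 \<and> (\<forall>t<21. r ! t = core (q + t)) \<and> shift_ok r p (drop p r)" for q
  proof -
    obtain n k where nk: "k < length (G3 (core n))"
      "\<And>t. t < 21 \<Longrightarrow> core (q + t) = (G3 (core n) @ G3 (core (Suc n))) ! (k + t)"
      by (rule image_word_window[where q = q, OF image_G3 len]) auto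
    define Y where "Y = G3 (core n) @ G3 (core (Suc n))"
    define r where "r = take 21 (drop k Y)"
    have "all_shifts (\<lambda>_ r. all_shifts (shift_ok (take 21 r)) 1 10 (tl (take 21 r))) 0 (length (G3 (core n))) Y"
      using shift_ok_blocks core_adjacent[of n] unfolding Y_def by auto
    then have "all_shifts (shift_ok r) 1 10 (tl r)"
      using nk(1) unfolding all_shifts_iff r_def by auto
    moreover have "p - 1 < 10" using p by simp
    ultimately have "shift_ok r (1 + (p - 1)) (drop (p - 1) (tl r))"
      unfolding all_shifts_iff by blast
    moreover have "drop (p - 1) (tl r) = drop p r" using p(1) by (simp add: drop_Suc[symmetric])
    moreover have "21 + k \<le> length Y" using len[of "core (Suc n)"] nk(1) unfolding Y_def by simp
    ultimately show ?thesis
      using nk(2) p(1) by (intro exI[of _ r]) (simp add: r_def Y_def[symmetric])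
  qed
  have agree: "m \<le> lcp_length (tl r) (tl (drop p r))"
    if "length r = 21" "\<forall>t<21. r ! t = core (q + t)" "matches core p (Suc q) (Suc q + m)" "m + p < 21" for r q m
  proof (rule lcp_length_geI)
    fix i assume i: "i < m"
    have "core (Suc q + i) = core (Suc q + i + p)" using i by (intro matchesD[OF that(3)]) auto
    then have "r ! Suc i = r ! (Suc i + p)" using that(2,4) i by (simp add: ac_simps)
    then show "tl r ! i = tl (drop p r) ! i" using that i by (simp add: nth_tl ac_simps)
  qed (use that in auto)
  show ?thesis
    unfolding defects_pos_def
  proof (intro conjI allI impI notI)
    fix q assume "matches core p q (q + p)"
    then have mt: "matches core p (Suc q) (Suc q + (p - 1))" "core q = core (q + p)"
      using p(1) by (auto simp: matches_def)
    obtain r where r: "length r = 21" "\<forall>t<21. r ! t = core (q + t)" "shift_ok r p (drop p r)" using window by blast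
    have "p - 1 \<le> lcp_length (tl r) (tl (drop p r))" using agree[OF r(1,2) mt(1)] p by simp
    then have "hd r \<noteq> hd (drop p r)" using r(3) p unfolding shift_ok_def by (auto split: if_splits)
    moreover have "hd r = core q" "hd (drop p r) = core (q + p)"
      using r p by (simp_all add: hd_drop_conv_nth hd_conv_nth flip: length_greater_0_conv)
    ultimately show False using mt(2) by simp
  next
    fix q e assume qe: "q < e" "e \<le> q + p" "matches core p (Suc q) e"
      and ne: "core q \<noteq> core (q + p)" "core e \<noteq> core (e + p)"
    obtain r where r: "length r = 21" "\<forall>t<21. r ! t = core (q + t)" "shift_ok r p (drop p r)" using window by blast
    have ag: "e - Suc q \<le> lcp_length (tl r) (tl (drop p r))"
      using agree[OF r(1,2), of "e - Suc q"] qe p by simp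
    have hds: "hd r = core q" "hd (drop p r) = core (q + p)"
      using r p by (simp_all add: hd_drop_conv_nth hd_conv_nth flip: length_greater_0_conv)
    consider "e = q + p" | "Suc e = q + p" | "Suc e < q + p" using qe(2) by linarith
    then show "H.s e + H.suf (core q) (core (q + p)) + H.pre (core e) (core (e + p)) < H.s (Suc (q + p))"
    proof cases
      case 1
      have "drop p r ! p = core (e + p)" using r p 1 by (simp add: ac_simps)
      then have "one_defect_pos (core q) (core (q + p)) (core (e + p))"
        using r(3) hds ag 1 p unfolding shift_ok_def by (auto split: if_splits)
      then show ?thesis using defect_one_iff[OF 1] by simp
    next
      case 2
      have "r ! (p - 1) = core e" "drop p r ! (p - 1) = core (e + p)"
      proof -
        have "q + (p - 1) = e" using 2 p by simp
        then show "r ! (p - 1) = core e" using r(2) p by auto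
        have "q + (p + (p - 1)) = e + p" using 2 p by simp
        then show "drop p r ! (p - 1) = core (e + p)" using r(1,2) p by auto
      qed
      moreover have "p \<noteq> 1" using 2 qe(1) by simp
      ultimately have "two_defect_pos (core q) (core (q + p)) (core e) (core (e + p))"
        using r(3) hds ag 2 p ne unfolding shift_ok_def by (auto split: if_splits)
      then show ?thesis using defect_two_iff[OF 2] by simp
    next
      case 3
      then show ?thesis using defect_large ne by blast
    qed
  qed
qed

lemma defects_pos_all: "0 < k \<Longrightarrow> defects_pos k"
proof (induction k rule: less_induct)
  case (less k)
  then show ?case using defects_pos_step[of k] defects_pos_small[of k] by (cases "k < 11") simp_all
qed

text \<open>The bound 19 is the longest block plus the marker, \<open>14 + 5\<close>. Both outcomes
  of desubstitution contradict the positive defects of the fixed point.\<close>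

lemma bin_no_large_square:
  assumes p: "19 \<le> p"
  shows "\<not> matches bin p i (i + p)"
proof
  assume mt: "matches bin p i (i + p)"
  obtain d where d: "d \<ge> H.s p" "\<forall>t<i + p + p. bin (t + d) = bin t"
    using recurrent_image[OF H_nonempty bin_image core_recurrent] unfolding recurrent_def by blast
  have "matches bin p (i + d) (i + p + d)" using matches_shift[OF d(2) _ mt] by simp
  moreover have "0 < p" "i + d + 14 + 5 \<le> i + p + d" "H.s p \<le> i + d" using p d by simp_all
  ultimately show False
  proof (rule H.desubstitute)
    fix k q assume "0 < k" "matches core k q (q + k)"
    then show False using defects_pos_all unfolding defects_pos_def by blast
  next
    fix k q e assume *: "0 < k" "q < e" "e \<le> q + k" "matches core k (Suc q) e"
      "core q \<noteq> core (q + k)" "core e \<noteq> core (e + k)"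
      "H.s (Suc (q + k)) = H.s (Suc q) + p"
      "H.s (Suc q) \<le> i + d + H.suf (core q) (core (q + k))"
      "i + p + d \<le> H.s e + H.pre (core e) (core (e + k))"
    have "H.s e + H.suf (core q) (core (q + k)) + H.pre (core e) (core (e + k)) < H.s (Suc (q + k))"
      using defects_pos_all[OF *(1)] *(2-6) unfolding defects_pos_def by blast
    then show False using *(7-9) by linarith
  qed
qed

subsection \<open>The binary word\<close>

lemma factors_iff: "v \<in> factors w \<longleftrightarrow> (\<exists>i. \<forall>t<length v. v ! t = w (i + t))"
proof
  assume "v \<in> factors w"
  then obtain i j where "v = map w [i..<j]" unfolding factors_def subsequence_def by blast
  then show "\<exists>i. \<forall>t<length v. v ! t = w (i + t)" by (intro exI[of _ i]) simp
next
  assume "\<exists>i. \<forall>t<length v. v ! t = w (i + t)"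
  then obtain i where "\<forall>t<length v. v ! t = w (i + t)" by blast
  then have "v = w [i \<rightarrow> i + length v]" by (intro nth_equalityI) (simp_all add: subsequence_def)
  then show "v \<in> factors w" unfolding factors_def by (metis (mono_tags, lifting) le_add1 mem_Collect_eq)
qed

lemma inj_on_square: "inj_on (\<lambda>u. u @ u) X"
proof (rule inj_onI)
  fix u v :: "'a list" assume eq: "u @ u = v @ v"
  then have "length (u @ u) = length (v @ v)" by (rule arg_cong)
  then have "length u = length v" by simp
  then show "u = v" using eq by simp
qed

lemma smallest_period:
  assumes "v \<noteq> []"
  shows "has_period v (smallest_period v)"
proof -
  have "has_period v (length v)" using assms by (simp add: has_period_def)
  then show ?thesis unfolding smallest_period_def by (rule LeastI)
qed

definition "HG2 c = concat (map H (G2 c))"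

definition roots :: "nat list list" where
  "roots = [[0],[1],[0,1],[1,0],[0,1,1],[1,1,0],[1,0,0],[0,0,1],[0,1,0],[1,0,1],
     [0,1,1,0,1,0,0,1],[1,0,0,1,0,1,1,0]]"

text \<open>With \<open>l\<close> matching positions a repetition has length \<open>l + p\<close>,
  so exponent at most 7/3 means \<open>3 * l \<le> 4 * p\<close>.\<close>

definition power_ok :: "nat list \<Rightarrow> nat \<Rightarrow> nat list \<Rightarrow> bool" where
  "power_ok r p t \<longleftrightarrow>
    (if p \<le> lcp_length r t then 3 * lcp_length r t \<le> 4 * p \<and> take p r \<in> set roots else True)"

text \<open>Length 43 is the first above 7/3 times 18, so windows of this length expose every
  violation for periods up to 18.\<close>

lemma power_ok_blocks: "\<forall>(c, d)\<in>set adjacent. all_shifts (\<lambda>_ r. all_shifts (power_ok (take 43 r)) 1 18 (tl (take 43 r))) 0 (length (HG2 c)) (HG2 c @ HG2 d)"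
  by code_simp



definition "HG c = concat (map H (G c))"
text \<open>The single block \<open>HG M\<close> contains all twelve squares, so one occurrence of
  \<open>M\<close> in the fixed point suffices.\<close>

lemma roots_occur: "\<forall>u\<in>set roots. \<exists>i\<in>set [0..<40]. take (length (u @ u)) (drop i (HG M)) = u @ u"
  by code_simp

lemma bin_window:
  obtains r where "length r = 43" "\<And>t. t < 43 \<Longrightarrow> r ! t = bin (i + t)"
    "\<And>p. 0 < p \<Longrightarrow> p < 19 \<Longrightarrow> power_ok r p (drop p r)"
proof -
  have im: "image_word HG2 core bin"
    using image_word_comp[OF image_G2 bin_image] unfolding HG2_def .
  have len: "43 \<le> length (HG2 c)" for c
  proof -
    have "\<forall>c\<in>set letters. 43 \<le> length (HG2 c)" by code_simp
    then show ?thesis by simp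
  qed
  obtain n k where nk: "k < length (HG2 (core n))"
    "\<And>t. t < 43 \<Longrightarrow> bin (i + t) = (HG2 (core n) @ HG2 (core (Suc n))) ! (k + t)"
    by (rule image_word_window[where q = i, OF im len]) auto
  define Y where "Y = HG2 (core n) @ HG2 (core (Suc n))"
  define r where "r = take 43 (drop k Y)"
  have "all_shifts (\<lambda>_ r. all_shifts (power_ok (take 43 r)) 1 18 (tl (take 43 r))) 0 (length (HG2 (core n))) Y"
    using power_ok_blocks core_adjacent[of n] unfolding Y_def by auto
  then have *: "all_shifts (power_ok r) 1 18 (tl r)"
    using nk(1) unfolding all_shifts_iff r_def by auto
  have len': "43 + k \<le> length Y" using len[of "core (Suc n)"] nk(1) unfolding Y_def by simp
  show ?thesis
  proof
    show "length r = 43" using len' by (simp add: r_def)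
    show "r ! t = bin (i + t)" if "t < 43" for t
      using nk(2) that len' by (simp add: r_def Y_def[symmetric])
    fix p :: nat assume p: "0 < p" "p < 19"
    then have "p - 1 < 18" by simp
    then have "power_ok r (1 + (p - 1)) (drop (p - 1) (tl r))" using * unfolding all_shifts_iff by blast
    moreover have "drop (p - 1) (tl r) = drop p r" using p(1) by (simp add: drop_Suc[symmetric])
    ultimately show "power_ok r p (drop p r)" using p by simp
  qed
qed

lemma bin_period_bound:
  assumes mt: "matches bin p i (i + m)" and p: "0 < p" "p \<le> m"
  shows "3 * m \<le> 4 * p" "map bin [i..<i + p] \<in> set roots"
proof -
  have "matches bin p i (i + p)" using mt p by (auto simp: matches_def)
  then have small: "p < 19" using bin_no_large_square[of p i] by (meson not_le)
  obtain r where r: "length r = 43" "\<And>t. t < 43 \<Longrightarrow> r ! t = bin (i + t)" "power_ok r p (drop p r)"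
    using bin_window[of i] p small by metis
  have ge: "l \<le> lcp_length r (drop p r)" if "l \<le> m" "l + p \<le> 43" for l
  proof (rule lcp_length_geI)
    fix t assume t: "t < l"
    then have "bin (i + t) = bin (i + t + p)" using that by (intro matchesD[OF mt]) auto
    then show "r ! t = drop p r ! t" using t that r(1,2) by (simp add: ac_simps)
  qed (use that r in auto)
  have "p \<le> lcp_length r (drop p r)" using ge p small by simp
  then have *: "3 * lcp_length r (drop p r) \<le> 4 * p" "take p r \<in> set roots"
    using r(3) unfolding power_ok_def by simp_all
  show "3 * m \<le> 4 * p"
  proof (rule ccontr)
    assume "\<not> ?thesis"
    \<comment> \<open>Cutting the run to the window keeps the violation: \<open>43 - p\<close> still
      exceeds 4/3 of \<open>p\<close> for \<open>p < 19\<close>.\<close>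
    then have "min m (43 - p) \<le> lcp_length r (drop p r)" "\<not> 3 * min m (43 - p) \<le> 4 * p"
      using ge[of "min m (43 - p)"] small by auto
    then show False using *(1) by linarith
  qed
  have "take p r = map bin [i..<i + p]"
    by (rule nth_equalityI) (use r(1,2) small in auto)
  then show "map bin [i..<i + p] \<in> set roots" using *(2) by simp
qed

lemma bin_binary: "binary_word bin"
  unfolding binary_word_def
proof
  fix a assume "a \<in> range bin"
  then obtain t where a: "a = bin t" by blast
  obtain n j where nj: "t = block_start H core n + j" "j < length (H (core n))"
    using image_word_position[of H t core] H_nonempty by blast
  have "set (H c) \<subseteq> {0, 1}" for c by (cases c) simp_all
  then show "a \<in> {0, 1}" using image_word_nth[OF bin_image nj(2)] nj(2) a nj(1) nth_mem by fastforce
qed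

lemma bin_exponents: "exponents_at_most (7/3) bin"
  unfolding exponents_at_most_def
proof (intro ballI impI)
  fix v assume v: "v \<in> factors bin" "v \<noteq> []"
  define p where "p = smallest_period v"
  obtain i where i: "\<forall>t<length v. v ! t = bin (i + t)" using v(1) factors_iff by blast
  have per: "has_period v p" unfolding p_def by (rule smallest_period[OF v(2)])
  then have p: "0 < p" by (simp add: has_period_def)
  have mt: "matches bin p i (i + (length v - p))"
    unfolding matches_def
  proof (intro allI impI)
    fix t assume t: "i \<le> t \<and> t < i + (length v - p)"
    then have "v ! (t - i) = v ! (t - i + p)" using per unfolding has_period_def by auto
    moreover have "v ! (t - i) = bin t" "v ! (t - i + p) = bin (t + p)"
      using i[rule_format, of "t - i"] i[rule_format, of "t - i + p"] t by auto
    ultimately show "bin t = bin (t + p)" by simp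
  qed
  have "3 * length v \<le> 7 * p"
    using bin_period_bound(1)[OF mt p] p by (cases "p \<le> length v - p") auto
  then have "real (3 * length v) \<le> real (7 * p)" by (rule of_nat_mono)
  then show "exponent v \<le> 7 / 3" unfolding exponent_def p_def[symmetric] using p by (simp add: field_simps)
qed

lemma bin_squares: "square_factors bin = (\<lambda>u. u @ u) ` set roots"
proof
  show "square_factors bin \<subseteq> (\<lambda>u. u @ u) ` set roots"
  proof
    fix v assume "v \<in> square_factors bin"
    then obtain u i where u: "u \<noteq> []" "v = u @ u" and i: "\<forall>t<length (u @ u). (u @ u) ! t = bin (i + t)"
      unfolding square_factors_def is_square_def factors_iff by blast
    let ?p = "length u"
    have fst: "u ! t = bin (i + t)" "u ! t = bin (i + (t + ?p))" if "t < ?p" for t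
      using i[rule_format, of t] i[rule_format, of "t + ?p"] that by (simp_all add: nth_append)
    have "matches bin ?p i (i + ?p)"
      unfolding matches_def
    proof (intro allI impI)
      fix t assume t: "i \<le> t \<and> t < i + ?p"
      then have "t - i < ?p" by linarith
      then have "bin (i + (t - i)) = bin (i + (t - i + ?p))" using fst[of "t - i"] by metis
      then show "bin t = bin (t + ?p)" using t by (metis add.assoc le_add_diff_inverse)
    qed
    then have "map bin [i..<i + ?p] \<in> set roots" using bin_period_bound(2) u(1) by simp
    moreover have "map bin [i..<i + ?p] = u" by (rule nth_equalityI) (simp_all add: fst(1))
    ultimately show "v \<in> (\<lambda>u. u @ u) ` set roots" using u(2) by simp
  qed
  show "(\<lambda>u. u @ u) ` set roots \<subseteq> square_factors bin"
  proof
    fix v assume "v \<in> (\<lambda>u. u @ u) ` set roots"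
    then obtain u where u: "u \<in> set roots" "v = u @ u" by blast
    have ne: "u \<noteq> []" using u(1) by (auto simp: roots_def)
    have im: "image_word HG core bin"
      using image_word_comp[OF core_fixed bin_image] unfolding HG_def .
    have "core 8 = M" using core_eq_nth[of 8 2] by (simp add: G_iter_def numeral_2_eq_2)
    obtain k where k: "take (length (u @ u)) (drop k (HG M)) = u @ u" using roots_occur u(1) by blast
    then have len: "length (u @ u) + k \<le> length (HG M)" using ne
      by (metis length_drop length_take min.cobounded1 append_is_Nil_conv le_diff_conv2 length_greater_0_conv nat_le_linear zero_less_diff less_imp_le drop_eq_Nil take_Nil)
    have "v ! t = bin (block_start HG core 8 + k + t)" if "t < length v" for t
    proof -
      have "bin (block_start HG core 8 + (k + t)) = HG M ! (k + t)"
        using image_word_nth[OF im, of "k + t" 8] \<open>core 8 = M\<close> that u(2) len by simp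
      also have "\<dots> = (u @ u) ! t" using that u(2) len k by (metis add_leD2 nth_drop nth_take)
      finally show ?thesis using u(2) by (simp add: add.assoc)
    qed
    then show "v \<in> square_factors bin"
      unfolding square_factors_def is_square_def factors_iff using u(2) ne by blast
  qed
qed

lemma bin_card_squares: "card (square_factors bin) = 12"
proof -
  have "card (square_factors bin) = card (set roots)"
    unfolding bin_squares by (rule card_image[OF inj_on_square])
  also have "\<dots> = 12" by (simp add: roots_def)
  finally show ?thesis .
qed

subsection \<open>The lower bound\<close>

lemma factors_infix:
  assumes "u @ v @ u' \<in> factors w"
  shows "v \<in> factors w"
proof -
  obtain i where i: "\<forall>t<length (u @ v @ u'). (u @ v @ u') ! t = w (i + t)"
    using assms factors_iff by blast
  have "v ! t = w (i + length u + t)" if "t < length v" for t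
    using i[rule_format, of "length u + t"] that by (simp add: nth_append add.assoc)
  then show ?thesis unfolding factors_iff by blast
qed

lemma exponent_ge:
  assumes "has_period v p" "v \<noteq> []"
  shows "real (length v) / real p \<le> exponent v"
proof -
  have "smallest_period v \<le> p" unfolding smallest_period_def using assms(1) by (rule Least_le)
  moreover have "0 < smallest_period v" using smallest_period[OF assms(2)] by (simp add: has_period_def)
  ultimately show ?thesis unfolding exponent_def by (intro divide_left_mono) auto
qed

text \<open>The first list serves only as a unary length, so prefixes are compared without
  arithmetic.\<close>

fun agree :: "'b list \<Rightarrow> 'a list \<Rightarrow> 'a list \<Rightarrow> bool" where
  "agree [] xs ys = True"
| "agree (c # cs) (x # xs) (y # ys) = (x = y \<and> agree cs xs ys)"
| "agree (c # cs) [] ys = False"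
| "agree (c # cs) (x # xs) [] = False"

lemma agreeD: "agree c xs ys \<Longrightarrow> length c \<le> length ys \<and> take (length c) xs = take (length c) ys"
  by (induction c xs ys rule: agree.induct) auto

text \<open>Words are explored reversed, latest letter first. In \<open>scan c t z r S\<close> the invariant is
  \<open>r = rev c @ t\<close>, and \<open>z\<close>, shortened by two letters per step, stops the scan at half the length
  of \<open>r\<close>. \<open>None\<close> reports an exponent above 7/3; \<open>S\<close> collects the roots of the squares seen.\<close>

fun scan :: "'a list \<Rightarrow> 'a list \<Rightarrow> 'a list \<Rightarrow> 'a list \<Rightarrow> 'a list list \<Rightarrow> 'a list list option" where
  "scan c (y # t) (_ # _ # z) r S =
     (if agree (y # c) r t
      then if 4 * length (y # c) < 3 * lcp_length r t then None
           else scan (y # c) t z r (List.insert (y # c) S)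
      else scan (y # c) t z r S)"
| "scan c _ _ r S = Some S"

text \<open>Running out of the depth bound \<open>n\<close> gives \<open>False\<close>, so
  \<open>True\<close> certifies that every branch closes: by a factor in \<open>X\<close> (stored
  reversed), an exponent above 7/3, or twelve roots. \<open>S\<close> is carried along the branch
  because \<open>scan\<close> sees only squares ending at the newest letter.\<close>

fun explore :: "nat list list \<Rightarrow> nat \<Rightarrow> nat list \<Rightarrow> nat list list \<Rightarrow> bool" where
  "explore X 0 r S = False"
| "explore X (Suc n) r S =
   (list_ex (\<lambda>f. agree f f r) X \<or>
   (case scan [] r r r S of None \<Rightarrow> True | Some S' \<Rightarrow>
      11 < length S' \<or> explore X n (0 # r) S' \<and> explore X n (Suc 0 # r) S'))"

definition square_roots_in :: "'a word \<Rightarrow> 'a list list \<Rightarrow> bool" where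
  "square_roots_in w S \<longleftrightarrow> distinct S \<and> (\<forall>u\<in>set S. u @ u \<in> square_factors w)"

lemma scan_sound:
  assumes "exponents_at_most (7/3) w" "rev r \<in> factors w" "r = rev c @ t" "square_roots_in w S"
  shows "\<exists>S'. scan c t z r S = Some S' \<and> square_roots_in w S'"
  using assms(2-)
proof (induction c t z r S rule: scan.induct)
  case (1 c y t z1 z2 z r S)
  let ?u = "y # c"
  have r: "r = rev ?u @ t" using 1(4) by simp
  show ?case
  proof (cases "agree ?u r t")
    case False
    then show ?thesis using 1(2)[OF False 1(3)] r 1(5) by simp
  next
    case True
    let ?m = "lcp_length r t"
    have "take (length ?u) t = rev ?u" using agreeD[OF True] r by simp
    then have "t = rev ?u @ drop (length ?u) t" by (metis append_take_drop_id)
    then have eq: "rev r = rev (drop (length ?u) t) @ (?u @ ?u) @ []"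
      using r by (metis append.assoc append.right_neutral rev_append rev_rev_ident)
    have "?u @ ?u \<in> factors w"
      using factors_infix[of "rev (drop (length ?u) t)" "?u @ ?u" "[]" w] 1(3) unfolding eq by blast
    then have "?u @ ?u \<in> square_factors w"
      unfolding square_factors_def is_square_def by blast
    then have S: "square_roots_in w (List.insert ?u S)" using 1(5) unfolding square_roots_in_def by auto
    have "\<not> 4 * length ?u < 3 * ?m"
    proof
      assume large: "4 * length ?u < 3 * ?m"
      define v where "v = rev (take (?m + length ?u) r)"
      have m: "?m \<le> length t" "?m + length ?u \<le> length r" using lcp_length_le(2)[of r t] r by auto
      have "rev r = rev (drop (?m + length ?u) r) @ v @ []"
        unfolding v_def by (metis append.right_neutral append_take_drop_id rev_append)
      then have v: "v \<in> factors w" using factors_infix 1(3) by metis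
      have len: "length v = ?m + length ?u" using m by (simp add: v_def)
      have "has_period v (length ?u)"
        unfolding has_period_def
      proof (intro conjI allI impI)
        fix i assume i: "i + length ?u < length v"
        define j where "j = ?m - Suc i"
        have j: "j < ?m" using i len unfolding j_def by simp
        have *: "v ! l = r ! (length v - Suc l)" if "l < length v" for l
          using that len m(2) unfolding v_def by (simp add: rev_nth)
        have "length v - Suc i = j + length ?u" "length v - Suc (i + length ?u) = j"
          using i len unfolding j_def by linarith+
        then have "v ! i = r ! (j + length ?u)" "v ! (i + length ?u) = r ! j"
          using *[of i] *[of "i + length ?u"] i by simp_all
        moreover have "r ! (j + length ?u) = t ! j" using r by (simp add: nth_append)
        ultimately show "v ! i = v ! (i + length ?u)" using nth_less_lcp_length[OF j] by simp
      qed simp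
      then have "real (length v) / real (length ?u) \<le> exponent v" using len by (intro exponent_ge) auto
      also have "\<dots> \<le> 7 / 3" using assms(1) v len unfolding exponents_at_most_def by auto
      finally have "3 * real (length v) \<le> 7 * real (length ?u)" by (simp add: field_simps)
      then have "3 * length v \<le> 7 * length ?u" by linarith
      then show False using large len by linarith
    qed
    then show ?thesis using 1(1)[OF True _ 1(3) _ S] True r by simp
  qed
qed (unfold scan.simps, blast+)

text \<open>Extending the occurrence of \<open>rev r\<close> at \<open>i\<close> along
  \<open>w\<close> selects one branch of the tree, and this branch can close only through twelve
  recorded roots.\<close>

lemma explore_sound:
  assumes w: "binary_word w" "exponents_at_most (7/3) w" "finite (square_factors w)"
    and X: "\<forall>f\<in>set X. rev f \<notin> factors w"
  shows "explore X n r S \<Longrightarrow> \<forall>t<length r. rev r ! t = w (i + t) \<Longrightarrow> square_roots_in w S \<Longrightarrow>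
    12 \<le> card (square_factors w)"
proof (induction n arbitrary: r S)
  case (Suc n)
  have fac: "rev r \<in> factors w" using Suc.prems(2) unfolding factors_iff by auto
  have "\<not> agree f f r" if "f \<in> set X" for f
  proof
    assume "agree f f r"
    then have "take (length f) r = f" using agreeD by fastforce
    then have "rev r = rev (drop (length f) r) @ rev f @ []"
      by (metis append.right_neutral append_take_drop_id rev_append)
    then show False using factors_infix fac X that by metis
  qed
  then have "\<not> list_ex (\<lambda>f. agree f f r) X" by (simp add: list_ex_iff)
  moreover obtain S' where S': "scan [] r r r S = Some S'" "square_roots_in w S'"
    using scan_sound[OF w(2) fac _ Suc.prems(3), of "[]" r r] by auto
  ultimately consider "11 < length S'" | "explore X n (0 # r) S'" "explore X n (Suc 0 # r) S'"
    using Suc.prems(1) by auto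
  then show ?case
  proof cases
    case 1
    have "card ((\<lambda>u. u @ u) ` set S') = length S'"
      using S'(2) unfolding square_roots_in_def by (simp add: card_image[OF inj_on_square] distinct_card)
    moreover have "(\<lambda>u. u @ u) ` set S' \<subseteq> square_factors w"
      using S'(2) unfolding square_roots_in_def by auto
    ultimately show ?thesis using card_mono[OF w(3), of "(\<lambda>u. u @ u) ` set S'"] 1 by linarith
  next
    case 2
    let ?a = "w (i + length r)"
    have "?a \<in> {0, 1}" using w(1) unfolding binary_word_def by blast
    then have "explore X n (?a # r) S'" using 2 by auto
    moreover have "\<forall>t<length (?a # r). rev (?a # r) ! t = w (i + t)"
      using Suc.prems(2) by (auto simp: nth_append less_Suc_eq)
    ultimately show ?thesis using Suc.IH S'(2) by blast
  qed
qed simp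

text \<open>The factor 10011010 and its complement were chosen because fixing or forbidding them
  makes the search trees small.\<close>

lemma explore_1: "explore [] 120 (rev [1,0,0,1,1,0,1,0]) [[0],[1]]"
  by code_simp

lemma explore_2: "explore [] 120 (rev [0,1,1,0,0,1,0,1]) [[0],[1]]"
  by code_simp

lemma explore_3: "explore [rev [1,0,0,1,1,0,1,0], rev [0,1,1,0,0,1,0,1]] 50 [] []"
  by code_simp


lemma card_squares_ge:
  assumes w: "binary_word w" "exponents_at_most (7/3) w" "finite (square_factors w)"
  shows "12 \<le> card (square_factors w)"
proof -
  let ?f = "[1,0,0,1,1,0,1,0] :: nat list" and ?g = "[0,1,1,0,0,1,0,1] :: nat list"
  have start: "12 \<le> card (square_factors w)"
    if f: "f \<in> factors w" and ex: "explore [] 120 (rev f) [[0],[1]]"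
      and zero: "\<exists>u v. f = u @ ([0] @ [0]) @ v" and one: "\<exists>u v. f = u @ ([1] @ [1]) @ v" for f
  proof -
    \<comment> \<open>The roots of 00 and 11 are supplied at the start: these squares lie inside the
      start word, where \<open>scan\<close> does not look for them.\<close>
    have "square_roots_in w [[0],[1]]"
    proof -
      have "[0] @ [0] \<in> factors w" "[1] @ [1] \<in> factors w" using f zero one factors_infix by metis+
      then have "[0] @ [0] \<in> square_factors w" "[1] @ [1] \<in> square_factors w"
        unfolding square_factors_def is_square_def by blast+
      then show ?thesis unfolding square_roots_in_def by simp
    qed
    moreover obtain i where i: "\<forall>t<length (rev f). rev (rev f) ! t = w (i + t)" using f unfolding factors_iff by auto
    ultimately show ?thesis using explore_sound[OF w _ ex i] by simp
  qed
  \<comment> \<open>If one of the two words occurs, the search starts from that occurrence;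
    otherwise it starts from the empty word with both forbidden.\<close>
  consider "?f \<in> factors w" | "?g \<in> factors w" | "?f \<notin> factors w" "?g \<notin> factors w" by blast
  then show ?thesis
  proof cases
    case 1
    show ?thesis
    proof (rule start[OF 1 explore_1])
      show "\<exists>u v. ?f = u @ ([0] @ [0]) @ v" by (rule exI[of _ "[1]"]) simp
      show "\<exists>u v. ?f = u @ ([1] @ [1]) @ v" by (rule exI[of _ "[1,0,0]"]) simp
    qed
  next
    case 2
    show ?thesis
    proof (rule start[OF 2 explore_2])
      show "\<exists>u v. ?g = u @ ([0] @ [0]) @ v" by (rule exI[of _ "[0,1,1]"]) simp
      show "\<exists>u v. ?g = u @ ([1] @ [1]) @ v" by (rule exI[of _ "[0]"]) simp
    qed
  next
    case 3
    have "square_roots_in w []" by (simp add: square_roots_in_def)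
    then show ?thesis using explore_sound[OF w _ explore_3, of 0] 3 by simp
  qed
qed
theorem theorem2:
  shows "(\<exists>w. binary_word w \<and> exponents_at_most (7/3) w \<and>
              finite (square_factors w) \<and> card (square_factors w) = 12) \<and>
         (\<forall>w. binary_word w \<and> exponents_at_most (7/3) w \<longrightarrow>
              infinite (square_factors w) \<or> card (square_factors w) \<ge> 12)"
proof
  have "finite (square_factors bin)" by (simp add: bin_squares)
  then show "\<exists>w. binary_word w \<and> exponents_at_most (7/3) w \<and>
      finite (square_factors w) \<and> card (square_factors w) = 12"
    using bin_binary bin_exponents bin_card_squares by blast
  show "\<forall>w. binary_word w \<and> exponents_at_most (7/3) w \<longrightarrow>
      infinite (square_factors w) \<or> card (square_factors w) \<ge> 12"
    using card_squares_ge by blast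
qed

end
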